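(* Let $f:\mathbb{R}^n\to\mathbb{R}$ be scaling-invariant. Then the conditions "$f(x)>0$ for all $x\neq 0$" and "$0$ is the unique global argmin of $f$" are equivalent. Let $f$ be additionally lower semi-continuous and assume that for all $x\in\mathbb{R}^n$, $f_x$ is continuous on a neighborhood of $0$ (in $[0,\infty)$). Then the following are equivalent: (i) $0$ is the unique global argmin of $f$. (ii) For any $x\in\mathbb{R}^n\setminus\{0\}$, the function $f_x$ is strictly increasing. (iii) The sublevel sets $\mathcal{L}^{\le}_{f,x}$ are compact for all $x\in\mathbb{R}^n$.
   Context: A function $f:\mathbb{R}^n\to\mathbb{R}$ is scaling-invariant (w.r.t. $0$) if for all $x,y\in\mathbb{R}^n$ and $\rho>0$: $f(x)\le f(y)\iff f(\rho x)\le f(\rho y)$. Standing convention: scaling-invariant functions are normalized so that the reference point is $0$ and $f(0)=0$. For $x\in\mathbb{R}^n$, $f_x:[0,\infty)\to\mathbb{R}$ is defined by $f_x(t)=f(tx)$, and $\mathcal{L}^{\le}_{f,x}=\{y\in\mathbb{R}^n: f(y)\le f(x)\}$. *)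

theory Defs
  imports "HOL-Analysis.Analysis"
begin

text \<open>Scaling invariance is with respect to the reference point \<open>0\<close>. The normalization
  \<open>f 0 = 0\<close> is not part of this definition.\<close>

definition scaling_invariant :: "('a::real_vector \<Rightarrow> real) \<Rightarrow> bool" where
  "scaling_invariant f \<longleftrightarrow>
     (\<forall>x y \<rho>. \<rho> > 0 \<longrightarrow> (f x \<le> f y \<longleftrightarrow> f (\<rho> *\<^sub>R x) \<le> f (\<rho> *\<^sub>R y)))"

text \<open>The function \<open>f\<^sub>x\<close>, which lives on \<open>[0, \<infinity>)\<close>. It is total here, so every use
  has to be restricted explicitly to \<open>{0..}\<close>.\<close>

definition ray_fun :: "('a::real_vector \<Rightarrow> real) \<Rightarrow> 'a \<Rightarrow> real \<Rightarrow> real" where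
  "ray_fun f x = (\<lambda>t. f (t *\<^sub>R x))"

definition sublevel_set :: "('a \<Rightarrow> real) \<Rightarrow> 'a \<Rightarrow> 'a set" where
  "sublevel_set f x = {y. f y \<le> f x}"

definition lower_semicontinuous :: "('a::topological_space \<Rightarrow> real) \<Rightarrow> bool" where
  "lower_semicontinuous f \<longleftrightarrow> (\<forall>x. \<forall>c < f x. \<forall>\<^sub>F z in nhds x. c < f z)"

definition unique_global_argmin :: "('a \<Rightarrow> real) \<Rightarrow> 'a \<Rightarrow> bool" where
  "unique_global_argmin f x \<longleftrightarrow> (\<forall>y. is_arg_min f (\<lambda>_. True) y \<longleftrightarrow> y = x)"

text \<open>Continuity on a neighborhood of \<open>0\<close> that is relative to \<open>[0, \<infinity>)\<close>.\<close>

definition continuous_near_0 :: "(real \<Rightarrow> real) \<Rightarrow> bool" where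
  "continuous_near_0 g \<longleftrightarrow>
     (\<exists>U. openin (top_of_set {0..}) U \<and> 0 \<in> U \<and> continuous_on U g)"

end

theory Submission
  imports Defs
begin

text \<open>Both arguments rest on scaling towards \<open>0\<close>. If \<open>f y \<le> f (\<rho> y)\<close> for some
  \<open>\<rho> < 1\<close>, then iterating gives \<open>f y \<le> f (\<rho>\<^sup>n y)\<close>, hence \<open>f y \<le> f 0\<close> by continuity along the
  ray; so positivity off \<open>0\<close> makes \<open>f\<close> strictly increasing on rays. For compactness, lower
  semicontinuity bounds \<open>f\<close> on the unit sphere from below by some \<open>m > 0\<close>; choosing \<open>r\<close> with
  \<open>f (x / r) < m\<close>, rescaling by \<open>r\<close> puts the sublevel set of \<open>x\<close> inside the ball of radius \<open>r\<close>.
  Conversely a point \<open>x \<noteq> 0\<close> with \<open>f x \<le> 0\<close> puts a whole ray into the sublevel set of \<open>0\<close>.\<close>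

lemma scaling_invariantD:
  assumes "scaling_invariant f" "\<rho> > 0"
  shows "f (\<rho> *\<^sub>R x) \<le> f (\<rho> *\<^sub>R y) \<longleftrightarrow> f x \<le> f y"
  using assms unfolding scaling_invariant_def by blast

text \<open>A relatively open \<open>U\<close> containing \<open>0\<close> is \<open>{0..}\<close>
  cut with an open set, so restricting to \<open>U\<close> or to \<open>{0..}\<close> gives the same
  filter at \<open>0\<close>.\<close>

lemma continuous_near_0_tendsto:
  assumes "continuous_near_0 g"
  shows "(g \<longlongrightarrow> g 0) (at 0 within {0..})"
proof -
  obtain U where U: "openin (top_of_set {0..}) U" "0 \<in> U" "continuous_on U g"
    using assms unfolding continuous_near_0_def by blast
  then have "(g \<longlongrightarrow> g 0) (at 0 within U)"
    by (simp add: continuous_on_def)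
  moreover obtain T where "open T" "U = {0..} \<inter> T"
    using U(1) by (auto simp: openin_open)
  then have "at 0 within U = at 0 within {0..}"
    using U(2) by (intro at_within_nhd[of 0 T]) auto
  ultimately show ?thesis by simp
qed

lemma continuous_near_0_sequentially:
  assumes "continuous_near_0 g" "\<And>n. a n > 0" "a \<longlonglongrightarrow> 0"
  shows "(\<lambda>n. g (a n)) \<longlonglongrightarrow> g 0"
proof (rule filterlim_compose[OF continuous_near_0_tendsto[OF assms(1)]])
  show "filterlim a (at 0 within {0..}) sequentially"
    using assms(2,3) by (auto simp: filterlim_at less_imp_le less_imp_neq[symmetric])
qed

text \<open>Uniqueness supplies the strict inequality: any \<open>y\<close> other than
  \<open>x\<close> is not minimal, so some \<open>z\<close> has a smaller value, and minimality of
  \<open>x\<close> gives \<open>f x \<le> f z\<close>.\<close>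

lemma unique_global_argmin_iff:
  "unique_global_argmin f x \<longleftrightarrow> (\<forall>y. y \<noteq> x \<longrightarrow> f x < f y)"
proof
  assume *: "unique_global_argmin f x"
  show "\<forall>y. y \<noteq> x \<longrightarrow> f x < f y"
  proof (intro allI impI)
    fix y assume "y \<noteq> x"
    then obtain z where "f z < f y"
      using * unfolding unique_global_argmin_def is_arg_min_def by auto
    moreover have "f x \<le> f z"
      using * unfolding unique_global_argmin_def is_arg_min_def by (auto simp: not_less)
    ultimately show "f x < f y" by simp
  qed
next
  assume *: "\<forall>y. y \<noteq> x \<longrightarrow> f x < f y"
  then have "f x \<le> f z" for z
    by (cases "z = x") (auto intro: less_imp_le)
  with * show "unique_global_argmin f x"
    unfolding unique_global_argmin_def is_arg_min_def by (metis not_less)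
qed

lemma lower_semicontinuous_open_superlevel:
  assumes "lower_semicontinuous f"
  shows "open {z. c < f z}"
proof (subst open_subopen, intro ballI)
  fix x assume "x \<in> {z. c < f z}"
  then have "\<forall>\<^sub>F z in nhds x. c < f z"
    using assms unfolding lower_semicontinuous_def by simp
  then show "\<exists>T. open T \<and> x \<in> T \<and> T \<subseteq> {z. c < f z}"
    unfolding eventually_nhds by auto
qed

lemma lower_semicontinuous_closed_sublevel:
  assumes "lower_semicontinuous f"
  shows "closed (sublevel_set f x)"
proof -
  have "- sublevel_set f x = {z. f x < f z}"
    unfolding sublevel_set_def by auto
  then show ?thesis
    using lower_semicontinuous_open_superlevel[OF assms] by (simp add: closed_def)
qed

text \<open>The open superlevel sets with positive levels cover \<open>K\<close>; the smallest level
  in a finite subcover is the bound.\<close>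

lemma lower_semicontinuous_compact_pos_lower_bound:
  assumes f: "lower_semicontinuous f" and K: "compact K" and pos: "\<And>x. x \<in> K \<Longrightarrow> 0 < f x"
  shows "\<exists>m>0. \<forall>x\<in>K. m < f x"
proof -
  have "K \<subseteq> (\<Union>c\<in>{0<..}. {z. c < f z})"
    using pos dense by blast
  then obtain C where C: "C \<subseteq> {0<..}" "finite C" "K \<subseteq> (\<Union>c\<in>C. {z. c < f z})"
    by (rule compactE_image[OF K lower_semicontinuous_open_superlevel[OF f]])
  \<comment> \<open>Inserting \<open>1\<close> keeps the minimum meaningful when \<open>C\<close> is
    empty.\<close>
  have "Min (insert 1 C) > 0"
    using C by auto
  moreover have "Min (insert 1 C) < f x" if x: "x \<in> K" for x
  proof -
    obtain c where "c \<in> C" "c < f x"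
      using C(3) x by blast
    moreover from this have "Min (insert 1 C) \<le> c"
      using C(2) by (intro Min_le) auto
    ultimately show ?thesis by simp
  qed
  ultimately show ?thesis by blast
qed

lemma scaling_invariant_strict_mono_on_ray:
  assumes f: "scaling_invariant f" and pos: "\<And>y. y \<noteq> 0 \<Longrightarrow> f 0 < f y"
    and cont: "\<And>y. continuous_near_0 (ray_fun f y)" and "x \<noteq> 0"
  shows "strict_mono_on {0..} (ray_fun f x)"
proof (rule strict_mono_onI)
  fix s t :: real
  assume "s \<in> {0..}" "s < t"
  then have "t > 0" by simp
  define y where "y = t *\<^sub>R x"
  have y: "f 0 < f y"
    using pos \<open>t > 0\<close> \<open>x \<noteq> 0\<close> by (simp add: y_def)
  show "ray_fun f x s < ray_fun f x t"
  proof (cases "s = 0")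
    \<comment> \<open>Here the ratio \<open>s / t\<close> would be \<open>0\<close>, which is not an
      admissible scaling factor; positivity of \<open>f\<close> off \<open>0\<close> settles the
      case directly.\<close>
    case True
    then show ?thesis using y by (simp add: ray_fun_def y_def)
  next
    case False
    define \<rho> where "\<rho> = s / t"
    have \<rho>: "0 < \<rho>" "\<rho> < 1" "s *\<^sub>R x = \<rho> *\<^sub>R y"
      using False \<open>s \<in> {0..}\<close> \<open>s < t\<close> by (auto simp: \<rho>_def y_def)
    show ?thesis
    proof (rule ccontr)
      assume "\<not> ?thesis"
      then have le: "f y \<le> f (\<rho> *\<^sub>R y)"
        using \<rho>(3) by (simp add: ray_fun_def y_def)
      have "f y \<le> f (\<rho> ^ n *\<^sub>R y)" for n
      proof (induction n)
        case (Suc n)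
        \<comment> \<open>This is \<open>le\<close> rescaled by the positive factor
          \<open>\<rho> ^ n\<close>.\<close>
        have "f (\<rho> ^ n *\<^sub>R y) \<le> f (\<rho> ^ n *\<^sub>R (\<rho> *\<^sub>R y))"
          using le scaling_invariantD[OF f] \<rho>(1) by (metis zero_less_power)
        with Suc show ?case by (simp add: mult.commute)
      qed simp
      moreover have "(\<lambda>n. ray_fun f y (\<rho> ^ n)) \<longlonglongrightarrow> ray_fun f y 0"
        using \<rho> by (intro continuous_near_0_sequentially[OF cont] LIMSEQ_realpow_zero) auto
      ultimately have "f y \<le> f 0"
        by (intro LIMSEQ_le_const) (auto simp: ray_fun_def)
      with y show False by simp
    qed
  qed
qed

lemma scaling_invariant_compact_sublevel:
  fixes f :: "'a::euclidean_space \<Rightarrow> real"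
  assumes f: "scaling_invariant f" "f 0 = 0" and pos: "\<And>y. y \<noteq> 0 \<Longrightarrow> 0 < f y"
    and lsc: "lower_semicontinuous f" and cont: "\<And>y. continuous_near_0 (ray_fun f y)"
  shows "compact (sublevel_set f x)"
proof -
  have "0 < f u" if "u \<in> sphere 0 1" for u
    using that by (intro pos) auto
  then obtain m where m: "m > 0" "\<And>u. u \<in> sphere 0 1 \<Longrightarrow> m < f u"
    using lower_semicontinuous_compact_pos_lower_bound[OF lsc compact_sphere] by blast
  \<comment> \<open>Shrinking \<open>x\<close> towards \<open>0\<close> drives the value to
    \<open>f 0 = 0\<close>, hence below \<open>m\<close>; the reciprocal of a suitable factor
    becomes the radius \<open>r\<close>.\<close>
  have "(\<lambda>n. ray_fun f x (inverse (real (Suc n)))) \<longlonglongrightarrow> ray_fun f x 0"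
    by (intro continuous_near_0_sequentially[OF cont] LIMSEQ_inverse_real_of_nat) simp
  then have "\<forall>\<^sub>F n in sequentially. ray_fun f x (inverse (real (Suc n))) < m"
    using m(1) f(2) by (intro order_tendstoD) (auto simp: ray_fun_def)
  then obtain n where n: "ray_fun f x (inverse (real (Suc n))) < m"
    by (auto simp: eventually_sequentially)
  define r where "r = real (Suc n)"
  have r: "r > 0" "f (inverse r *\<^sub>R x) < m"
    using n by (auto simp: r_def ray_fun_def)
  have "norm y \<le> r" if "y \<in> sublevel_set f x" for y
  proof (rule ccontr)
    assume "\<not> norm y \<le> r"
    then have y: "norm y > r" by simp
    define u where "u = y /\<^sub>R norm y"
    have "y \<noteq> 0" using y r(1) by auto
    then have u: "u \<in> sphere 0 1" "y = norm y *\<^sub>R u" "u \<noteq> 0"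
      by (auto simp: u_def)
    \<comment> \<open>The bound \<open>m\<close> separates the two values. Rescaling by
      \<open>r\<close> compares \<open>x\<close> with the point of norm \<open>r\<close> on the ray
      of \<open>y\<close>, and strict growth along that ray carries the inequality out to
      \<open>y\<close>.\<close>
    have "f (inverse r *\<^sub>R x) < f u"
      using r(2) m(2)[OF u(1)] by simp
    then have "f x < f (r *\<^sub>R u)"
      using scaling_invariantD[OF f(1) r(1), of u "inverse r *\<^sub>R x"] r(1)
      by fastforce
    also have "\<dots> < f (norm y *\<^sub>R u)"
    proof -
      have "strict_mono_on {0..} (ray_fun f u)"
        using scaling_invariant_strict_mono_on_ray[OF f(1) _ cont u(3)] pos f(2) by simp
      then show ?thesis
        using strict_mono_onD[of "{0..}" "ray_fun f u" r "norm y"] y r(1) by (simp add: ray_fun_def)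
    qed
    also have "\<dots> = f y"
      using u(2) by simp
    finally show False
      using that by (simp add: sublevel_set_def)
  qed
  then have "bounded (sublevel_set f x)"
    by (auto simp: bounded_iff)
  then show ?thesis
    using lower_semicontinuous_closed_sublevel[OF lsc] by (simp add: compact_eq_bounded_closed)
qed

lemma scaling_invariant_bounded_sublevel_pos:
  fixes f :: "'a::real_normed_vector \<Rightarrow> real"
  assumes f: "scaling_invariant f" and bdd: "bounded (sublevel_set f 0)" and "x \<noteq> 0"
  shows "f 0 < f x"
proof (rule ccontr)
  assume "\<not> f 0 < f x"
  then have "f (\<rho> *\<^sub>R x) \<le> f 0" if "\<rho> > 0" for \<rho>
    using scaling_invariantD[OF f that, of x 0] by simp
  moreover obtain B where B: "B > 0" "\<And>y. y \<in> sublevel_set f 0 \<Longrightarrow> norm y \<le> B"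
    using bdd unfolding bounded_pos by blast
  \<comment> \<open>This factor stretches \<open>x\<close> to norm \<open>2 * B\<close>, beyond the
    bound \<open>B\<close>.\<close>
  moreover have "(2 * B / norm x) > 0"
    using B(1) \<open>x \<noteq> 0\<close> by simp
  ultimately have "norm ((2 * B / norm x) *\<^sub>R x) \<le> B"
    unfolding sublevel_set_def by blast
  then show False
    using B(1) \<open>x \<noteq> 0\<close> by simp
qed

theorem theorem4p2:
  fixes f :: "real ^ 'n \<Rightarrow> real"
  assumes "scaling_invariant f" and "f 0 = 0"
  shows "((\<forall>x. x \<noteq> 0 \<longrightarrow> f x > 0) \<longleftrightarrow> unique_global_argmin f 0) \<and>
         (lower_semicontinuous f \<and> (\<forall>x. continuous_near_0 (ray_fun f x)) \<longrightarrow>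
            (unique_global_argmin f 0 \<longleftrightarrow>
               (\<forall>x. x \<noteq> 0 \<longrightarrow> strict_mono_on {0..} (ray_fun f x))) \<and>
            ((\<forall>x. x \<noteq> 0 \<longrightarrow> strict_mono_on {0..} (ray_fun f x)) \<longleftrightarrow>
               (\<forall>x. compact (sublevel_set f x))))"
proof -
  \<comment> \<open>Positivity off \<open>0\<close> is the hub: each of the three conditions is
    shown equivalent to it.\<close>
  have "(\<forall>x. x \<noteq> 0 \<longrightarrow> f x > 0) \<longleftrightarrow> unique_global_argmin f 0"
    by (simp add: unique_global_argmin_iff assms(2))
  moreover have "(\<forall>x. x \<noteq> 0 \<longrightarrow> f x > 0) \<longleftrightarrow>
      (\<forall>x. x \<noteq> 0 \<longrightarrow> strict_mono_on {0..} (ray_fun f x))"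
    if "\<forall>x. continuous_near_0 (ray_fun f x)"
  proof (intro iffI allI impI)
    fix x :: "real ^ 'n"
    assume "\<forall>x. x \<noteq> 0 \<longrightarrow> f x > 0" "x \<noteq> 0"
    then show "strict_mono_on {0..} (ray_fun f x)"
      using scaling_invariant_strict_mono_on_ray[OF assms(1)] that assms(2) by simp
  next
    fix x :: "real ^ 'n"
    assume "\<forall>x. x \<noteq> 0 \<longrightarrow> strict_mono_on {0..} (ray_fun f x)" "x \<noteq> 0"
    then show "f x > 0"
      using strict_mono_onD[of "{0..}" "ray_fun f x" 0 1] assms(2) by (simp add: ray_fun_def)
  qed
  moreover have "(\<forall>x. x \<noteq> 0 \<longrightarrow> f x > 0) \<longleftrightarrow> (\<forall>x. compact (sublevel_set f x))"
    if "lower_semicontinuous f" "\<forall>x. continuous_near_0 (ray_fun f x)"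
  proof (intro iffI allI impI)
    fix x
    assume "\<forall>x. x \<noteq> 0 \<longrightarrow> f x > 0"
    then show "compact (sublevel_set f x)"
      using scaling_invariant_compact_sublevel[OF assms _ that(1)] that(2) by simp
  next
    fix x :: "real ^ 'n"
    assume "\<forall>x. compact (sublevel_set f x)" "x \<noteq> 0"
    then show "f x > 0"
      using scaling_invariant_bounded_sublevel_pos[OF assms(1), of x] assms(2) compact_imp_bounded
      by auto
  qed
  ultimately show ?thesis by blast
qed

end
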